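(* Let $X$ be a topological space. Then $\mathrm{Homeo}(X) = \mathrm{bij}(X)$ if and only if $X$ is cocardinal.
   Context: $\mathrm{Homeo}(X)$ is the set of all homeomorphisms from $X$ to $X$, and $\mathrm{bij}(X)$ is the set of all bijective maps from $X$ to $X$. For a cardinal number $\kappa$, the co-$\kappa$ topology on $X$ is the topology whose open sets are exactly the empty set and the subsets of $X$ whose complement has cardinality (strictly) less than $\kappa$. The co-$\kappa$ topology is not defined for $1 < \kappa < \aleph_0$, so these values of $\kappa$ are excluded. The co-$1$ topology is the trivial topology, and the co-$\kappa$ topology is the discrete topology if $\kappa$ is bigger than the cardinality of $X$. A topological space is called cocardinal if its topology is the co-$\kappa$ topology for some cardinal $\kappa$. *)

theory Defs
  imports "HOL-Analysis.Abstract_Topology" "HOL-Algebra.Bij"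
begin

unbundle cardinal_syntax

text \<open>
  The set of all bijections from \<open>S\<close> to \<open>S\<close> is the library's \<^term>\<open>Bij S\<close>. As there, maps are
  taken to be extensional (undefined off the carrier), so that two maps which agree on the
  carrier are equal.
\<close>

definition Homeo :: "'a topology \<Rightarrow> ('a \<Rightarrow> 'a) set" where
  "Homeo X = extensional (topspace X) \<inter> {f. homeomorphic_map X X f}"

text \<open>
  A cardinal number is a relation satisfying \<^const>\<open>Card_order\<close>; \<^const>\<open>cone\<close> and
  \<^const>\<open>natLeq\<close> are the cardinals one and aleph-zero. For cardinal zero the following
  predicate is satisfied only by the empty space, whose topology is also the co-1 topology.
\<close>

definition has_co_topology :: "'b rel \<Rightarrow> 'a topology \<Rightarrow> bool" where
  "has_co_topology \<kappa> X \<longleftrightarrow>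
     (\<forall>U. openin X U \<longleftrightarrow> U = {} \<or> (U \<subseteq> topspace X \<and> |topspace X - U| <o \<kappa>))"

definition admissible_cardinal :: "'b rel \<Rightarrow> bool" where
  "admissible_cardinal \<kappa> \<longleftrightarrow> Card_order \<kappa> \<and> \<not> (cone <o \<kappa> \<and> \<kappa> <o natLeq)"

text \<open>
  The existential quantifier over cardinals needs a type for them to live on. The type
  \<open>('a + nat) set\<close> is infinite and larger than \<open>'a\<close>, even when \<open>'a\<close> is finite; the lemma
  \<open>cocardinalI\<close> below shows that cardinals on any other type yield no further spaces.
\<close>

definition cocardinal :: "'a topology \<Rightarrow> bool" where
  "cocardinal X \<longleftrightarrow>
     (\<exists>\<kappa> :: ('a + nat) set rel. admissible_cardinal \<kappa> \<and> has_co_topology \<kappa> X)"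

lemma ordLess_cong_ordIso: "r =o r' \<Longrightarrow> s <o r \<longleftrightarrow> s <o r'"
  by (meson ordIso_symmetric ordLess_ordIso_trans)

lemma cocardinalI:
  fixes X :: "'a topology" and \<kappa> :: "'b rel"
  assumes adm: "admissible_cardinal \<kappa>" and co: "has_co_topology \<kappa> X"
  shows "cocardinal X"
proof -
  let ?M = "|UNIV :: ('a + nat) set set|"
  have card: "Card_order \<kappa>"
    using adm by (simp add: admissible_cardinal_def)
  show ?thesis
  proof (cases "\<kappa> \<le>o ?M")
    case True
    then obtain p :: "('a + nat) set rel" where p: "\<kappa> =o p"
      by (metis internalize_ordLeq)
    have "Card_order p"
      using card p Card_order_ordIso2 by blast
    moreover have "cone <o \<kappa> \<longleftrightarrow> cone <o p" and "|S| <o \<kappa> \<longleftrightarrow> |S| <o p" for S :: "'a set"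
      using p by (rule ordLess_cong_ordIso)+
    moreover have "\<kappa> <o natLeq \<longleftrightarrow> p <o natLeq"
      by (meson p ordIso_symmetric ordIso_ordLess_trans)
    ultimately have "admissible_cardinal p" "has_co_topology p X"
      using adm co by (simp_all add: admissible_cardinal_def has_co_topology_def)
    then show ?thesis
      unfolding cocardinal_def by blast
  next
    case False
    then have M_less: "?M <o \<kappa>"
      using card by (meson card_of_Well_order card_order_on_def not_ordLeq_iff_ordLess)
    have "|S| \<le>o |Inl ` S :: ('a + nat) set|" for S :: "'a set"
      by (metis card_of_ordLeq inj_Inl inj_on_subset order_refl subset_UNIV)
    moreover have "|T| <o ?M" for T :: "('a + nat) set"
      by (metis Pow_UNIV card_of_Pow card_of_mono1 ordLeq_ordLess_trans subset_UNIV)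
    ultimately have small: "|S| <o ?M" for S :: "'a set"
      by (meson ordLeq_ordLess_trans)
    have large: "|S| <o \<kappa>" for S :: "'a set"
      using small M_less by (rule ordLess_transitive)
    have "\<not> finite (UNIV :: ('a + nat) set set)"
      by (simp add: Finite_Set.finite_set)
    then have "\<not> ?M <o natLeq"
      by (simp add: finite_iff_ordLess_natLeq)
    then have "admissible_cardinal ?M"
      by (simp add: admissible_cardinal_def card_of_Card_order)
    moreover have "has_co_topology ?M X"
      using co small large by (simp add: has_co_topology_def)
    ultimately show ?thesis
      unfolding cocardinal_def by blast
  qed
qed

end

theory Submission
  imports Defs
begin

text \<open>
  Suppose every permutation of the space is a homeomorphism. Exchanging points of a closed set \<open>C\<close>
  against points outside it again gives a closed set. If \<open>C\<close> is proper, \<open>|D| \<le> |C|\<close> and \<open>x \<notin> D\<close>,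
  first exchange to achieve \<open>x \<notin> C\<close>, then exchange a subset of \<open>C\<close> against \<open>D - C\<close>: the union of
  the old and the new closed set contains \<open>D\<close> and still misses \<open>x\<close>. Hence \<open>D\<close> is an intersection
  of closed sets. So the proper closed sets are exactly the sets smaller than a non-closed
  set of least cardinality, if there is one, and otherwise the space is discrete.
\<close>

text \<open>Maps in \<open>Bij\<close> and \<open>Homeo\<close> are extensional, so the equation is
  applied to \<open>restrict f (topspace X)\<close>, which agrees with \<open>f\<close> on
  \<open>C\<close>.\<close>

lemma closedin_bij_image:
  assumes "Homeo X = Bij (topspace X)" "bij_betw f (topspace X) (topspace X)" "closedin X C"
  shows "closedin X (f ` C)"
proof -
  have C: "C \<subseteq> topspace X"
    using assms(3) closedin_subset by blast
  have "bij_betw (restrict f (topspace X)) (topspace X) (topspace X)"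
    using assms(2) bij_betw_restrict_eq by blast
  then have "restrict f (topspace X) \<in> Homeo X"
    using assms(1) by (simp add: Bij_def)
  then have "homeomorphic_map X X (restrict f (topspace X))"
    by (simp add: Homeo_def)
  then have "closedin X (restrict f (topspace X) ` C)"
    using C assms(3) homeomorphic_map_closedness by blast
  then show ?thesis
    using image_cong[of C C "restrict f (topspace X)" f] C by (metis restrict_apply' subsetD)
qed

text \<open>Swap each point of \<open>E\<close> with its image under \<open>g\<close> and fix all
  other points. This is well defined because \<open>E\<close> lies outside \<open>C\<close> and its
  image inside, and it is an involution, hence bijective.\<close>

lemma bij_betw_exchange:
  assumes "E \<subseteq> S - C" "inj_on g E" "g ` E \<subseteq> C" "C \<subseteq> S"
  obtains f where "bij_betw f S S" "f ` C = (C - g ` E) \<union> E"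
proof
  define f where
    "f x = (if x \<in> E then g x else if x \<in> g ` E then the_inv_into E g x else x)" for x
  have f_E: "f x = g x" if "x \<in> E" for x
    using that by (simp add: f_def)
  have f_gE: "f (g x) = x" if "x \<in> E" for x
  proof -
    have "g x \<notin> E"
      using that assms(1,3) by blast
    then show ?thesis
      using that assms(2) by (simp add: f_def the_inv_into_f_f)
  qed
  have f_other: "f x = x" if "x \<notin> E" "x \<notin> g ` E" for x
    using that by (simp add: f_def)
  have f_f: "f (f x) = x" for x
    using f_E f_gE f_other by (cases "x \<in> E"; cases "x \<in> g ` E") auto
  have "f x \<in> S" if "x \<in> S" for x
  proof (cases "x \<in> g ` E")
    case True
    then show ?thesis
      using f_gE assms(1) by auto
  next
    case False
    then show ?thesis
      using f_E f_other assms(3,4) that by (cases "x \<in> E") auto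
  qed
  then show "bij_betw f S S"
    using f_f by (intro bij_betw_byWitness[where f' = f]) auto
  have "f ` C = f ` (C - g ` E) \<union> f ` (g ` E)"
    using assms(3) by blast
  moreover have "f ` (C - g ` E) = C - g ` E"
    using f_other assms(1) by (intro image_cong[where g = "\<lambda>x. x", simplified]) auto
  moreover have "f ` (g ` E) = E"
    using f_gE by (simp add: image_image)
  ultimately show "f ` C = (C - g ` E) \<union> E"
    by simp
qed

lemma closedin_exchange:
  assumes "Homeo X = Bij (topspace X)" "closedin X C"
    and "E \<subseteq> topspace X - C" "inj_on g E" "g ` E \<subseteq> C"
  shows "closedin X ((C - g ` E) \<union> E)"
proof -
  obtain f where f: "bij_betw f (topspace X) (topspace X)" "f ` C = (C - g ` E) \<union> E"
    using assms(3-5) closedin_subset[OF assms(2)] by (rule bij_betw_exchange)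
  show ?thesis
    using closedin_bij_image[OF assms(1) f(1) assms(2)] unfolding f(2) .
qed

lemma closedin_if_card_of_ordLeq:
  assumes hom: "Homeo X = Bij (topspace X)"
    and C: "closedin X C" "C \<noteq> topspace X"
    and D: "D \<subseteq> topspace X" "|D| \<le>o |C|"
  shows "closedin X D"
proof -
  have separate: "\<exists>K. closedin X K \<and> D \<subseteq> K \<and> x \<notin> K" if "x \<in> topspace X - D" for x
  proof -
    obtain C' where C': "closedin X C'" "x \<notin> C'" "|C| \<le>o |C'|"
    proof (cases "x \<in> C")
      case False
      then show ?thesis
        using that C card_of_mono1 by blast
    next
      case True
      obtain u where u: "u \<in> topspace X - C"
        using C closedin_subset by blast
      have "closedin X ((C - {x}) \<union> {u})"
        using closedin_exchange[OF hom C(1), of "{u}" "\<lambda>_. x"] u True by simp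
      moreover have "x \<noteq> u"
        using u True by blast
      \<comment> \<open>Sending \<open>x\<close> to \<open>u\<close> and fixing the rest shows that
        the exchange has not shrunk the set.\<close>
      moreover have "inj_on (id(x := u)) C" "(id(x := u)) ` C \<subseteq> (C - {x}) \<union> {u}"
        using u by (auto simp: inj_on_def)
      then have "|C| \<le>o |(C - {x}) \<union> {u}|"
        using card_of_ordLeq by blast
      ultimately show ?thesis
        using that by blast
    qed
    obtain g where g: "inj_on g D" "g ` D \<subseteq> C'"
      using ordLeq_transitive[OF D(2) C'(3)] card_of_ordLeq by metis
    let ?C'' = "(C' - g ` (D - C')) \<union> (D - C')"
    have "closedin X ?C''"
      using D(1) g by (intro closedin_exchange[OF hom C'(1)]) (auto intro: inj_on_subset)
    then have "closedin X (C' \<union> ?C'')"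
      using C'(1) by blast
    then show ?thesis
      using that C'(2) by blast
  qed
  \<comment> \<open>Inserting the whole space makes it visible that the family is nonempty and that
    its intersection stays inside the space, where \<open>separate\<close> removes every point
    outside \<open>D\<close>.\<close>
  define \<K> where "\<K> = insert (topspace X) {K. closedin X K \<and> D \<subseteq> K}"
  have "D = \<Inter>\<K>"
    using D(1) separate unfolding \<K>_def by blast
  moreover have "closedin X (\<Inter>\<K>)"
    unfolding \<K>_def by (rule closedin_Inter) auto
  ultimately show ?thesis
    by simp
qed

text \<open>Any cardinal above all subsets of the space gives the discrete topology. By Cantor's
  theorem the power set of \<open>'a + nat\<close> supplies one; the summand \<open>nat\<close>
  makes it infinite, hence admissible.\<close>

lemma cocardinal_if_all_closedin:
  assumes "\<And>D. D \<subseteq> topspace X \<Longrightarrow> closedin X D"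
  shows "cocardinal X"
proof (rule cocardinalI)
  let ?M = "|UNIV :: ('a + nat) set set|"
  have "\<not> finite (UNIV :: ('a + nat) set set)"
    by (simp add: Finite_Set.finite_set)
  then show "admissible_cardinal ?M"
    by (simp add: admissible_cardinal_def card_of_Card_order finite_iff_ordLess_natLeq)
  have small: "|S| <o ?M" for S :: "'a set"
  proof -
    have "|S| \<le>o |Inl ` S :: ('a + nat) set|"
      by (metis card_of_ordLeq inj_Inl inj_on_subset order_refl subset_UNIV)
    moreover have "|Inl ` S :: ('a + nat) set| <o |Pow (Inl ` S :: ('a + nat) set)|"
      by (rule card_of_Pow)
    moreover have "|Pow (Inl ` S :: ('a + nat) set)| \<le>o ?M"
      by (rule card_of_mono1) simp
    ultimately show ?thesis
      by (meson ordLeq_ordLess_trans ordLess_ordLeq_trans)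
  qed
  have "openin X U \<longleftrightarrow> U \<subseteq> topspace X" for U
    using assms[of "topspace X - U"] by (auto simp: openin_closedin_eq)
  then show "has_co_topology ?M X"
    using small by (auto simp: has_co_topology_def)
qed

lemma closedin_finite_if_singletons:
  assumes "finite D" "\<And>x. x \<in> D \<Longrightarrow> closedin X {x}"
  shows "closedin X D"
  using closedin_Union[of "(\<lambda>x. {x}) ` D" X] assms by auto

lemma cocardinal_if_Homeo_eq_Bij:
  assumes hom: "Homeo X = Bij (topspace X)"
  shows "cocardinal X"
proof (cases "\<forall>D \<subseteq> topspace X. closedin X D")
  case True
  then show ?thesis
    by (intro cocardinal_if_all_closedin) blast
next
  case False
  define N where "N = {D. D \<subseteq> topspace X \<and> \<not> closedin X D}"
  \<comment> \<open>Well-foundedness of \<open><o\<close>, pulled back along \<open>card_of\<close>,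
    yields a non-closed \<open>D\<close> of least cardinality; \<open>|D|\<close> will be the
    required cardinal.\<close>
  have "wf (inv_image ordLess (card_of :: 'a set \<Rightarrow> _))"
    by (intro wf_inv_image wf_ordLess)
  moreover have "\<exists>D. D \<in> N"
    using False unfolding N_def by blast
  ultimately obtain D where D: "D \<in> N"
    and N_min: "\<And>C. (C, D) \<in> inv_image ordLess card_of \<Longrightarrow> C \<notin> N"
    by (metis wfE_min)
  have min: "closedin X C" if "C \<subseteq> topspace X" "|C| <o |D|" for C
    using that N_min[of C] by (simp add: N_def)
  have D_sub: "D \<subseteq> topspace X" and D_not: "\<not> closedin X D"
    using D by (simp_all add: N_def)
  \<comment> \<open>The whole space is closed whatever its size, so it is excluded here; it
    corresponds to the separate case \<open>U = {}\<close> in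
    \<open>has_co_topology\<close>.\<close>
  have proper_closed_iff: "closedin X C \<longleftrightarrow> |C| <o |D|"
    if "C \<subseteq> topspace X" "C \<noteq> topspace X" for C
  proof
    assume "closedin X C"
    then have "\<not> |D| \<le>o |C|"
      using that(2) closedin_if_card_of_ordLeq[OF hom _ _ D_sub] D_not by blast
    then show "|C| <o |D|"
      using not_ordLeq_iff_ordLess[OF card_of_Well_order card_of_Well_order] by blast
  qed (use min that in blast)
  show ?thesis
  proof (rule cocardinalI)
    \<comment> \<open>If \<open>D\<close> were finite with more than one point, singletons would be
      closed by minimality, and so would their finite union \<open>D\<close>.\<close>
    have False if one: "cone <o |D|" and fin: "|D| <o natLeq"
    proof -
      have "finite D"
        using fin finite_iff_ordLess_natLeq by blast
      moreover have "closedin X {x}" if "x \<in> D" for x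
      proof (rule min)
        have "|{x}| =o cone"
          unfolding cone_def by (intro card_of_ordIsoI[of "\<lambda>_. ()"]) (simp add: bij_betw_def)
        then show "|{x}| <o |D|"
          using one ordIso_ordLess_trans by blast
      qed (use that D_sub in blast)
      ultimately show False
        using D_not closedin_finite_if_singletons by blast
    qed
    then show "admissible_cardinal |D|"
      by (auto simp: admissible_cardinal_def card_of_Card_order)
    show "has_co_topology |D| X"
      unfolding has_co_topology_def
    proof
      fix U
      show "openin X U \<longleftrightarrow> U = {} \<or> (U \<subseteq> topspace X \<and> |topspace X - U| <o |D| )"
      proof (cases "U \<noteq> {} \<and> U \<subseteq> topspace X")
        case True
        then have "topspace X - U \<noteq> topspace X"
          by blast
        then show ?thesis
          using True proper_closed_iff[of "topspace X - U"] by (simp add: openin_closedin_eq)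
      next
        case False
        then show ?thesis
          using openin_subset[of X U] by auto
      qed
    qed
  qed
qed

text \<open>A bijection carries the complement of \<open>U\<close> onto the complement of the image
  of \<open>U\<close>. It preserves the cardinality of complements, and hence openness in both
  directions.\<close>

lemma homeomorphic_map_if_cocardinal:
  assumes "cocardinal X" and bij: "bij_betw f (topspace X) (topspace X)"
  shows "homeomorphic_map X X f"
proof -
  obtain \<kappa> :: "('a + nat) set rel" where co: "has_co_topology \<kappa> X"
    using assms(1) unfolding cocardinal_def by blast
  have inj: "inj_on f (topspace X)" and img: "f ` topspace X = topspace X"
    using bij by (auto simp: bij_betw_def)
  have image: "openin X (f ` U) \<longleftrightarrow> openin X U" if U: "U \<subseteq> topspace X" for U
  proof -
    have "topspace X - f ` U = f ` (topspace X - U)"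
      using inj_on_image_set_diff[OF inj Diff_subset U] img by simp
    moreover have "|f ` (topspace X - U)| =o |topspace X - U|"
      using card_of_ordIsoI[OF inj_on_imp_bij_betw[OF inj_on_subset[OF inj Diff_subset]]]
      by (rule ordIso_symmetric)
    ultimately have "|topspace X - f ` U| <o \<kappa> \<longleftrightarrow> |topspace X - U| <o \<kappa>"
      by (metis ordIso_ordLess_trans ordIso_symmetric)
    moreover have "f ` U \<subseteq> topspace X"
      using U img by blast
    ultimately show ?thesis
      using co U by (simp add: has_co_topology_def)
  qed
  show ?thesis
  proof (rule bijective_open_imp_homeomorphic_map)
    show "open_map X X f"
      by (simp add: open_map_def image openin_subset)
    \<comment> \<open>By surjectivity \<open>f\<close> maps the preimage of \<open>V\<close> onto
      \<open>V\<close>, so \<open>image\<close> read from left to right gives continuity.\<close>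
    have "openin X {x \<in> topspace X. f x \<in> V}" if V: "openin X V" for V
    proof -
      have "V \<subseteq> f ` topspace X"
        using openin_subset[OF V] img by simp
      then have "f ` {x \<in> topspace X. f x \<in> V} = V"
        by blast
      then show ?thesis
        using image[of "{x \<in> topspace X. f x \<in> V}"] V by auto
    qed
    then show "continuous_map X X f"
      using img by (auto simp: continuous_map_def)
  qed (use inj img in auto)
qed

theorem theorem1:
  fixes X :: "'a topology"
  shows "Homeo X = Bij (topspace X) \<longleftrightarrow> cocardinal X"
proof
  show "cocardinal X" if "Homeo X = Bij (topspace X)"
    using that by (rule cocardinal_if_Homeo_eq_Bij)
  \<comment> \<open>Homeomorphisms are bijective in any space; the reverse inclusion is the
    preceding lemma.\<close>
  show "Homeo X = Bij (topspace X)" if "cocardinal X"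
    using homeomorphic_map_if_cocardinal[OF that]
    by (auto simp: Homeo_def Bij_def bij_betw_def homeomorphic_eq_everything_map)
qed

end
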